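(* Let $A, B$ be alphabets, let $F$ be a free commutative semigroup of finite rank larger than one, and let $\varphi : A^{+} \to F$, $\psi : B^{+} \to F$ be two epimorphisms. Then the fiber product $\Pi(\varphi,\psi) = \{(u,v) \in A^{+}\times B^{+} : \varphi(u) = \psi(v)\}$ is not finitely generated (as a semigroup).
   Context: For an alphabet $A$, $A^{+}$ is the free semigroup of non-empty finite words over $A$ under concatenation. "Epimorphism" means surjective homomorphism. $\Pi(\varphi,\psi)$ is a subsemigroup of the direct product $A^{+}\times B^{+}$. The free commutative semigroup of rank $r$ is $\mathbb{N}_0^{r}\setminus\{0\}$ under addition, up to isomorphism. *)

theory Defs
  imports "HOL-Algebra.Group"
begin

text \<open>
  Semigroups are represented by the record type of HOL-Algebra, so that its \<open>epi\<close>, \<open>\<cong>\<close> and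
  \<open>\<times>\<times>\<close> apply. These notions depend only on the carrier and the multiplication; the field
  \<open>one\<close> plays no role and is left undefined, since the semigroups below have no identity.
\<close>

definition free_semigroup :: "'a set \<Rightarrow> 'a list monoid" where
  "free_semigroup A = \<lparr>carrier = lists A - {[]}, mult = (@), one = undefined\<rparr>"

definition nonzero_vectors :: "nat \<Rightarrow> (nat \<Rightarrow> nat) monoid" where
  "nonzero_vectors r =
     \<lparr>carrier = {v. \<forall>i\<ge>r. v i = 0} - {\<lambda>_. 0}, mult = (\<lambda>u v i. u i + v i), one = undefined\<rparr>"

text \<open>
  The isomorphism is directed towards \<open>F\<close> because \<open>hom\<close> does not require its source to be closed
  under multiplication. In this direction closure, associativity and commutativity carry over
  to \<open>F\<close>, as the lemma states.
\<close>

definition free_comm_semigroup :: "nat \<Rightarrow> ('f, 'z) monoid_scheme \<Rightarrow> bool" where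
  "free_comm_semigroup r F \<longleftrightarrow> nonzero_vectors r \<cong> F"

lemma free_comm_semigroup_laws:
  assumes "free_comm_semigroup r F" "x \<in> carrier F" "y \<in> carrier F" "z \<in> carrier F"
  shows "x \<otimes>\<^bsub>F\<^esub> y \<in> carrier F"
    and "(x \<otimes>\<^bsub>F\<^esub> y) \<otimes>\<^bsub>F\<^esub> z = x \<otimes>\<^bsub>F\<^esub> (y \<otimes>\<^bsub>F\<^esub> z)"
    and "x \<otimes>\<^bsub>F\<^esub> y = y \<otimes>\<^bsub>F\<^esub> x"
proof -
  let ?N = "nonzero_vectors r"
  obtain h where h: "h \<in> iso ?N F"
    using assms(1) by (auto simp: free_comm_semigroup_def is_iso_def)
  have car: "carrier F = h ` carrier ?N"
    using h by (auto simp: iso_def bij_betw_def)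
  have hm: "h (u \<otimes>\<^bsub>?N\<^esub> v) = h u \<otimes>\<^bsub>F\<^esub> h v" if "u \<in> carrier ?N" "v \<in> carrier ?N" for u v
    using h that by (auto simp: iso_def hom_def)
  have cl: "u \<otimes>\<^bsub>?N\<^esub> v \<in> carrier ?N" if "u \<in> carrier ?N" "v \<in> carrier ?N" for u v
    using that by (auto simp: nonzero_vectors_def fun_eq_iff)
  have ac: "(u \<otimes>\<^bsub>?N\<^esub> v) \<otimes>\<^bsub>?N\<^esub> w = u \<otimes>\<^bsub>?N\<^esub> (v \<otimes>\<^bsub>?N\<^esub> w)" "u \<otimes>\<^bsub>?N\<^esub> v = v \<otimes>\<^bsub>?N\<^esub> u" for u v w
    by (auto simp: nonzero_vectors_def fun_eq_iff)
  obtain u v w where uvw: "u \<in> carrier ?N" "v \<in> carrier ?N" "w \<in> carrier ?N"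
      and eq: "x = h u" "y = h v" "z = h w"
    using assms(2-4) car by auto
  show "x \<otimes>\<^bsub>F\<^esub> y \<in> carrier F"
    unfolding eq car using hm[OF uvw(1,2)] cl[OF uvw(1,2)] by (metis imageI)
  show "(x \<otimes>\<^bsub>F\<^esub> y) \<otimes>\<^bsub>F\<^esub> z = x \<otimes>\<^bsub>F\<^esub> (y \<otimes>\<^bsub>F\<^esub> z)"
    unfolding eq using uvw by (metis hm cl ac(1))
  show "x \<otimes>\<^bsub>F\<^esub> y = y \<otimes>\<^bsub>F\<^esub> x"
    unfolding eq using uvw by (metis hm ac(2))
qed

definition fiber_product ::
    "'a set \<Rightarrow> 'b set \<Rightarrow> ('a list \<Rightarrow> 'f) \<Rightarrow> ('b list \<Rightarrow> 'f) \<Rightarrow> ('a list \<times> 'b list) monoid" where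
  "fiber_product A B \<phi> \<psi> =
     (free_semigroup A \<times>\<times> free_semigroup B)
       \<lparr>carrier := {(u, v) \<in> carrier (free_semigroup A) \<times> carrier (free_semigroup B). \<phi> u = \<psi> v}\<rparr>"

inductive_set subsemigroup_generated :: "('s, 'z) monoid_scheme \<Rightarrow> 's set \<Rightarrow> 's set"
  for S and X where
  incl: "x \<in> X \<Longrightarrow> x \<in> subsemigroup_generated S X"
| mult: "x \<in> subsemigroup_generated S X \<Longrightarrow> y \<in> subsemigroup_generated S X \<Longrightarrow>
    x \<otimes>\<^bsub>S\<^esub> y \<in> subsemigroup_generated S X"

definition finitely_generated_semigroup :: "('s, 'z) monoid_scheme \<Rightarrow> bool" where
  "finitely_generated_semigroup S \<longleftrightarrow>
     (\<exists>X. finite X \<and> X \<subseteq> carrier S \<and> subsemigroup_generated S X = carrier S)"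

end

theory Submission
  imports Defs
begin

text \<open>
  An element that is not a product of two elements lies in every generating set, so it is enough
  to find infinitely many indecomposable pairs in the fiber product. Identify \<open>F\<close> with the nonzero
  vectors of length \<open>r\<close>. A unit vector is not a sum of two nonzero vectors, so any preimage of it
  is a single letter: there are letters \<open>a\<^sub>0, a\<^sub>1 \<in> A\<close> and \<open>b\<^sub>0, b\<^sub>1 \<in> B\<close> over the first two unit
  vectors (this is where \<open>1 < r\<close> enters). For \<open>n > 0\<close> the pair \<open>(a\<^sub>0\<^sup>n a\<^sub>1\<^sup>n, b\<^sub>1\<^sup>n b\<^sub>0\<^sup>n)\<close> belongs to the
  fiber product. It is indecomposable because its two words run from zero to the same vector
  \<open>(n, n)\<close> along opposite sides of a square: a proper nonempty prefix of the first word
  has image \<open>(k, 0)\<close> with \<open>0 < k \<le> n\<close> or \<open>(n, k)\<close> with \<open>0 < k < n\<close>, a proper nonempty prefix of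
  the second has image \<open>(0, k)\<close> or \<open>(k, n)\<close> with the same bounds, and these sets of vectors
  are disjoint. Hence no factorization of the pair has a first factor in the fiber product.
\<close>

lemma indecomposable_in_generating_set:
  assumes gen: "subsemigroup_generated S X = carrier S"
    and "s \<in> carrier S"
    and indec: "\<And>x y. x \<in> carrier S \<Longrightarrow> y \<in> carrier S \<Longrightarrow> s \<noteq> x \<otimes>\<^bsub>S\<^esub> y"
  shows "s \<in> X"
proof -
  have "s \<in> subsemigroup_generated S X"
    using gen assms(2) by simp
  then show ?thesis
    by cases (use gen indec in auto)
qed

lemma free_comm_semigroup_coordinates:
  assumes "free_comm_semigroup r F"
  obtains \<pi> where "\<pi> \<in> epi F (nonzero_vectors r)" "inj_on \<pi> (carrier F)"
proof -
  let ?N = "nonzero_vectors r"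
  obtain h where h: "h \<in> iso ?N F"
    using assms by (auto simp: free_comm_semigroup_def is_iso_def)
  define \<pi> where "\<pi> = inv_into (carrier ?N) h"
  have bij: "bij_betw h (carrier ?N) (carrier F)"
    using h by (simp add: iso_def)
  then have bij': "bij_betw \<pi> (carrier F) (carrier ?N)"
    unfolding \<pi>_def by (rule bij_betw_inv_into)
  have "\<pi> (x \<otimes>\<^bsub>F\<^esub> y) = \<pi> x \<otimes>\<^bsub>?N\<^esub> \<pi> y" if xy: "x \<in> carrier F" "y \<in> carrier F" for x y
  proof -
    have in_N: "\<pi> x \<in> carrier ?N" "\<pi> y \<in> carrier ?N"
      using bij' xy by (auto dest: bij_betwE)
    then have "\<pi> x \<otimes>\<^bsub>?N\<^esub> \<pi> y \<in> carrier ?N"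
      by (auto simp: nonzero_vectors_def fun_eq_iff)
    moreover have "h (\<pi> x \<otimes>\<^bsub>?N\<^esub> \<pi> y) = x \<otimes>\<^bsub>F\<^esub> y"
      using h in_N xy bij by (auto simp: iso_def hom_def \<pi>_def bij_betw_inv_into_right)
    ultimately show ?thesis
      unfolding \<pi>_def using bij by (metis bij_betw_inv_into_left)
  qed
  then have "\<pi> \<in> epi F ?N"
    using bij' by (auto simp: epi_def hom_def bij_betw_def)
  then show thesis
    using bij' that by (auto simp: bij_betw_def)
qed

lemma epi_comp:
  assumes "f \<in> epi G H" "g \<in> epi H K"
  shows "g \<circ> f \<in> epi G K"
proof -
  have "\<And>x. x \<in> carrier G \<Longrightarrow> f x \<in> carrier H"
    using assms(1) by (auto simp: epi_def)
  moreover have "(g \<circ> f) ` carrier G = carrier K"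
    using assms by (simp add: epi_def flip: image_image image_comp)
  ultimately show ?thesis
    using assms by (auto simp: epi_def hom_def)
qed

text \<open>
  Only equality of images matters for the fiber product, so the common target may be renamed.
\<close>

lemma fiber_product_inj_comp:
  assumes "\<phi> \<in> hom (free_semigroup A) F" "\<psi> \<in> hom (free_semigroup B) F"
    and "inj_on \<pi> (carrier F)"
  shows "fiber_product A B (\<pi> \<circ> \<phi>) (\<pi> \<circ> \<psi>) = fiber_product A B \<phi> \<psi>"
proof -
  have "\<pi> (\<phi> u) = \<pi> (\<psi> v) \<longleftrightarrow> \<phi> u = \<psi> v"
    if "u \<in> carrier (free_semigroup A)" "v \<in> carrier (free_semigroup B)" for u v
    using assms that by (auto simp: hom_def Pi_def inj_on_eq_iff)
  then have "{(u, v) \<in> carrier (free_semigroup A) \<times> carrier (free_semigroup B).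
               (\<pi> \<circ> \<phi>) u = (\<pi> \<circ> \<psi>) v} =
             {(u, v) \<in> carrier (free_semigroup A) \<times> carrier (free_semigroup B). \<phi> u = \<psi> v}"
    by auto
  then show ?thesis
    by (simp only: fiber_product_def)
qed

lemma hom_nonzero_vectors_append:
  assumes "\<phi> \<in> hom (free_semigroup A) (nonzero_vectors r)"
    and "u \<in> lists A" "u \<noteq> []" "v \<in> lists A" "v \<noteq> []"
  shows "\<phi> (u @ v) = (\<lambda>i. \<phi> u i + \<phi> v i)"
  using assms by (auto simp: hom_def free_semigroup_def nonzero_vectors_def)

lemma hom_nonzero_vectors_nonzero:
  assumes "\<phi> \<in> hom (free_semigroup A) (nonzero_vectors r)"
    and "u \<in> lists A" "u \<noteq> []"
  obtains i where "0 < \<phi> u i"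
proof -
  have "\<phi> u \<in> carrier (nonzero_vectors r)"
    using assms by (auto simp: hom_def free_semigroup_def)
  then show thesis
    using that by (auto simp: nonzero_vectors_def fun_eq_iff)
qed

lemma hom_nonzero_vectors_eq_sum_list:
  assumes hom: "\<phi> \<in> hom (free_semigroup A) (nonzero_vectors r)"
    and "u \<in> lists A" "u \<noteq> []"
  shows "\<phi> u i = (\<Sum>x\<leftarrow>u. \<phi> [x] i)"
  using assms(3,2)
proof (induction u rule: list_nonempty_induct)
  case (cons x xs)
  then show ?case
    using hom_nonzero_vectors_append[OF hom, of "[x]" xs] by simp
qed simp

definition unit_vector :: "nat \<Rightarrow> nat \<Rightarrow> nat" where
  "unit_vector i = (\<lambda>_. 0)(i := 1)"

lemma letter_over_unit_vector:
  assumes epi: "\<phi> \<in> epi (free_semigroup A) (nonzero_vectors r)" and "i < r"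
  obtains a where "a \<in> A" "\<phi> [a] = unit_vector i"
proof -
  have hom: "\<phi> \<in> hom (free_semigroup A) (nonzero_vectors r)"
    using epi by (simp add: epi_def)
  have "unit_vector i \<in> carrier (nonzero_vectors r)"
    using \<open>i < r\<close> by (auto simp: unit_vector_def nonzero_vectors_def fun_eq_iff)
  then have "unit_vector i \<in> \<phi> ` (lists A - {[]})"
    using epi by (simp add: epi_def free_semigroup_def)
  then obtain u where "unit_vector i = \<phi> u" "u \<in> lists A - {[]}"
    by (rule imageE)
  then have u: "u \<in> lists A" "u \<noteq> []" and eq: "\<phi> u = unit_vector i"
    by simp_all
  obtain a w where u_eq: "u = [a] @ w"
    using u(2) by (cases u) auto
  have aw: "a \<in> A" "w \<in> lists A"
    using u(1) u_eq by auto
  have "w = []"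
  proof (rule ccontr)
    assume "w \<noteq> []"
    then have sum: "unit_vector i j = \<phi> [a] j + \<phi> w j" for j
      using hom_nonzero_vectors_append[OF hom, of "[a]" w] aw eq u_eq
      by (simp add: fun_eq_iff)
    obtain j where j: "0 < \<phi> [a] j"
      using hom_nonzero_vectors_nonzero[OF hom, of "[a]"] aw by auto
    obtain k where k: "0 < \<phi> w k"
      using hom_nonzero_vectors_nonzero[OF hom aw(2) \<open>w \<noteq> []\<close>] by auto
    show False
      using sum[of j] sum[of k] j k by (auto simp: unit_vector_def split: if_splits)
  qed
  then show thesis
    using that aw eq u_eq by simp
qed

text \<open>
  Truncated subtraction makes one formula cover both sides of the square: \<open>length u - n\<close>
  stays at zero until the prefix has used up the first block.
\<close>

lemma hom_prefix_of_two_blocks: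
  assumes hom: "\<phi> \<in> hom (free_semigroup A) (nonzero_vectors r)"
    and ab: "a \<in> A" "\<phi> [a] = unit_vector i" "b \<in> A" "\<phi> [b] = unit_vector j" and "i \<noteq> j"
    and u: "u @ u' = replicate n a @ replicate n b" "u \<noteq> []"
  shows "\<phi> u = (\<lambda>_. 0)(i := min (length u) n, j := min (length u - n) n)"
proof
  fix k
  have u_eq: "u = replicate (min (length u) n) a @ replicate (min (length u - n) n) b"
    using arg_cong[OF u(1), of "take (length u)"] by (simp add: min_def)
  have "set u \<subseteq> {a, b}"
    using arg_cong[OF u(1), of set] by (auto split: if_splits)
  then have "u \<in> lists A"
    using ab by auto
  then have "\<phi> u k = (\<Sum>x\<leftarrow>u. \<phi> [x] k)"
    using hom u(2) by (intro hom_nonzero_vectors_eq_sum_list)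
  also have "\<dots> = min (length u) n * unit_vector i k + min (length u - n) n * unit_vector j k"
    by (subst u_eq) (simp add: ab sum_list_replicate)
  also have "\<dots> = ((\<lambda>_. 0)(i := min (length u) n, j := min (length u - n) n)) k"
    using \<open>i \<noteq> j\<close> by (simp add: unit_vector_def)
  finally show "\<phi> u k = ((\<lambda>_. 0)(i := min (length u) n, j := min (length u - n) n)) k" .
qed

theorem mainTheorem8:
  fixes A :: "'a set" and B :: "'b set" and F :: "('f, 'z) monoid_scheme" and r :: nat
    and \<phi> :: "'a list \<Rightarrow> 'f" and \<psi> :: "'b list \<Rightarrow> 'f"
  assumes "free_comm_semigroup r F" and "1 < r"
    and "\<phi> \<in> epi (free_semigroup A) F"
    and "\<psi> \<in> epi (free_semigroup B) F"
  shows "\<not> finitely_generated_semigroup (fiber_product A B \<phi> \<psi>)"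
proof -
  obtain \<pi> where \<pi>: "\<pi> \<in> epi F (nonzero_vectors r)" "inj_on \<pi> (carrier F)"
    using free_comm_semigroup_coordinates assms(1) by blast
  define f g where "f = \<pi> \<circ> \<phi>" and "g = \<pi> \<circ> \<psi>"
  have epi: "f \<in> epi (free_semigroup A) (nonzero_vectors r)"
            "g \<in> epi (free_semigroup B) (nonzero_vectors r)"
    unfolding f_def g_def using assms(3,4) \<pi>(1) by (blast intro: epi_comp)+
  then have hom: "f \<in> hom (free_semigroup A) (nonzero_vectors r)"
                 "g \<in> hom (free_semigroup B) (nonzero_vectors r)"
    by (simp_all add: epi_def)
  define P where "P = fiber_product A B f g"
  have P_eq: "fiber_product A B \<phi> \<psi> = P"
    unfolding P_def f_def g_def using assms(3,4) \<pi>(2)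
    by (intro fiber_product_inj_comp[symmetric]) (auto simp: epi_def)
  have carrier_P: "(u, v) \<in> carrier P \<longleftrightarrow>
      u \<in> lists A \<and> u \<noteq> [] \<and> v \<in> lists B \<and> v \<noteq> [] \<and> f u = g v" for u v
    by (auto simp: P_def fiber_product_def free_semigroup_def)
  have mult_P: "(u, v) \<otimes>\<^bsub>P\<^esub> (u', v') = (u @ u', v @ v')" for u v u' v'
    by (simp add: P_def fiber_product_def free_semigroup_def DirProd_def)

  obtain a0 a1 where a: "a0 \<in> A" "f [a0] = unit_vector 0" "a1 \<in> A" "f [a1] = unit_vector 1"
    using letter_over_unit_vector[OF epi(1)] assms(2) by (metis less_trans zero_less_one)
  obtain b0 b1 where b: "b0 \<in> B" "g [b0] = unit_vector 0" "b1 \<in> B" "g [b1] = unit_vector 1"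
    using letter_over_unit_vector[OF epi(2)] assms(2) by (metis less_trans zero_less_one)
  note f_prefix = hom_prefix_of_two_blocks[OF hom(1) a zero_neq_one]
  note g_prefix = hom_prefix_of_two_blocks[OF hom(2) b(3,4,1,2) one_neq_zero]
  define s where "s n = (replicate n a0 @ replicate n a1, replicate n b1 @ replicate n b0)" for n

  have s_in: "s n \<in> carrier P" if "0 < n" for n
    using that a(1,3) b(1,3) f_prefix[of _ "[]" n] g_prefix[of _ "[]" n]
    by (auto simp: s_def carrier_P fun_eq_iff)
  have s_indec: "s n \<noteq> x \<otimes>\<^bsub>P\<^esub> y" if xy: "x \<in> carrier P" "y \<in> carrier P" for n x y
  proof
    assume eq: "s n = x \<otimes>\<^bsub>P\<^esub> y"
    obtain u v u' v' where x: "x = (u, v)" and y: "y = (u', v')"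
      by (cases x, cases y)
    have u: "u @ u' = replicate n a0 @ replicate n a1"
      and v: "v @ v' = replicate n b1 @ replicate n b0"
      using eq by (simp_all add: x y s_def mult_P)
    have nonempty: "u \<noteq> []" "u' \<noteq> []" "v \<noteq> []" "v' \<noteq> []" and fg: "f u = g v"
      using xy by (auto simp: x y carrier_P)
    have "length u + length u' = 2 * n" "length v + length v' = 2 * n"
      using arg_cong[OF u, of length] arg_cong[OF v, of length] by simp_all
    moreover have "min (length u) n = min (length v - n) n"
                  "min (length u - n) n = min (length v) n"
      using fun_cong[OF fg, of 0] fun_cong[OF fg, of 1]
      by (simp_all add: f_prefix[OF u nonempty(1)] g_prefix[OF v nonempty(3)])
    moreover have "0 < length u" "0 < length u'" "0 < length v" "0 < length v'"
      using nonempty by simp_all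
    ultimately show False
      by (simp add: min_def split: if_splits)
  qed

  show ?thesis
    unfolding P_eq finitely_generated_semigroup_def
  proof
    assume "\<exists>X. finite X \<and> X \<subseteq> carrier P \<and> subsemigroup_generated P X = carrier P"
    then obtain X where X: "finite X" "subsemigroup_generated P X = carrier P"
      by blast
    have "s ` {0<..} \<subseteq> X"
      using indecomposable_in_generating_set[OF X(2)] s_in s_indec by blast
    then have "finite (s ` {0<..})"
      using X(1) by (rule finite_subset)
    moreover have "inj s"
    proof (rule injI)
      fix m n assume "s m = s n"
      then have "length (fst (s m)) = length (fst (s n))"
        by simp
      then show "m = n"
        by (simp add: s_def)
    qed
    ultimately have "finite {0::nat<..}"
      by (meson finite_imageD inj_on_subset subset_UNIV)
    then show False
      by (simp add: infinite_Ioi)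
  qed
qed

end
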